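(* Suppose that $\mathcal{D}=\{(A_i^{(1)},\dots,A_i^{(d)})\}_{1\le i\le m}$ is a strong Bollobás system of $d$-partitions of $[n]$. Then $$\sum_{i=1}^{m}\binom{\sum_{r=1}^{d}|A_i^{(r)}|}{|A_i^{(1)}|,\ldots,|A_i^{(d)}|}^{-1}\le1,$$ and the upper bound is tight.
   Context: For a positive integer $n$, $[n]=\{1,\dots,n\}$. Let $d\ge 2$. A $d$-partition of $[n]$ is a tuple $(A^{(1)},\dots,A^{(d)})$ of (possibly empty) pairwise disjoint subsets of $[n]$; their union need not be all of $[n]$. A family $\{(A_i^{(1)},\dots,A_i^{(d)})\}_{1\le i\le m}$ of $d$-partitions of $[n]$ is called a strong Bollobás system if for any $1\leq i<j\leq m$ there exist $1\leq u_1<u_2\leq d$ and $1\leq v_1<v_2\leq d$ such that $A_i^{(u_1)}\cap A_j^{(v_2)}\neq \emptyset$ and $A_i^{(u_2)}\cap A_j^{(v_1)}\neq \emptyset$. For non-negative integers $a_1,\ldots,a_d$ with $a_1+\cdots+a_d\le N$, $\binom{N}{a_1,\ldots,a_d}=\frac{N!}{a_1!\cdots a_d!(N-a_1-\cdots-a_d)!}$. *)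

theory Defs
  imports Complex_Main "HOL-Library.Disjoint_Sets"
begin

text \<open>
  A tuple of \<open>d\<close> subsets is a function on indices of which only the values at \<open>1, \<dots>, d\<close> matter.
  Parts may be empty and need not cover \<open>{1..n}\<close>.
\<close>

definition d_partition :: "nat \<Rightarrow> nat \<Rightarrow> (nat \<Rightarrow> nat set) \<Rightarrow> bool" where
  "d_partition n d P \<longleftrightarrow>
     (\<forall>r\<in>{1..d}. P r \<subseteq> {1..n}) \<and> disjoint_family_on P {1..d}"

text \<open>
  In a family of \<open>m\<close> tuples, \<open>A i r\<close> is the \<open>r\<close>-th part of the \<open>i\<close>-th tuple.
\<close>

definition strong_bollobas_system :: "nat \<Rightarrow> nat \<Rightarrow> nat \<Rightarrow> (nat \<Rightarrow> nat \<Rightarrow> nat set) \<Rightarrow> bool" where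
  "strong_bollobas_system n d m A \<longleftrightarrow>
     (\<forall>i\<in>{1..m}. d_partition n d (A i)) \<and>
     (\<forall>i j. 1 \<le> i \<and> i < j \<and> j \<le> m \<longrightarrow>
        (\<exists>u1 u2 v1 v2. 1 \<le> u1 \<and> u1 < u2 \<and> u2 \<le> d \<and> 1 \<le> v1 \<and> v1 < v2 \<and> v2 \<le> d \<and>
           A i u1 \<inter> A j v2 \<noteq> {} \<and> A i u2 \<inter> A j v1 \<noteq> {}))"

text \<open>
  The multinomial coefficient with lower entries \<open>a 1, \<dots>, a d\<close> and the implicit last entry
  \<open>N - (a 1 + \<dots> + a d)\<close>; it is meaningful only for \<open>a 1 + \<dots> + a d \<le> N\<close>, since the
  subtraction is truncated.
\<close>

definition multinomial :: "nat \<Rightarrow> nat \<Rightarrow> (nat \<Rightarrow> nat) \<Rightarrow> real" where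
  "multinomial N d a =
     fact N / ((\<Prod>r = 1..d. fact (a r)) * fact (N - (\<Sum>r = 1..d. a r)))"

definition bollobas_sum :: "nat \<Rightarrow> nat \<Rightarrow> (nat \<Rightarrow> nat \<Rightarrow> nat set) \<Rightarrow> real" where
  "bollobas_sum d m A =
     (\<Sum>i = 1..m. inverse (multinomial (\<Sum>r = 1..d. card (A i r)) d (\<lambda>r. card (A i r))))"

end

theory Submission
  imports Defs "HOL-Combinatorics.Multiset_Permutations"
begin

text \<open>
  The reciprocal multinomial coefficient of a tuple \<open>P\<close> is a probability: in a uniformly random linear
  ordering of a finite ground set, it is the chance that all of \<open>P 1\<close> comes before all of \<open>P 2\<close>, all of
  \<open>P 2\<close> before all of \<open>P 3\<close>, and so on. Two tuples \<open>P\<close> and \<open>Q\<close> that cross in the sense of a strong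
  Bollobas system cannot both be ordered in this way: an element \<open>x\<close> of \<open>P u1 \<inter> Q v2\<close> and an element
  \<open>y\<close> of \<open>P u2 \<inter> Q v1\<close> would have to satisfy both \<open>x < y\<close> and \<open>y < x\<close>. So the events belonging to a
  strong Bollobas system are disjoint, and their probabilities add up to at most \<open>1\<close>.

  The formal argument never mentions orderings. It reveals a random ordering one element at a time,
  from the front: the weight of a tuple is the average, over the first element \<open>x\<close>, of the weight that
  remains after \<open>x\<close> is removed, or of \<open>0\<close> if \<open>x\<close> cannot come first
  (\<open>sum_ordering_weight_remove_first\<close>). Tuples that cross and survive the choice of \<open>x\<close> still cross
  (\<open>crossing_remove_first\<close>), so the bound follows by induction on the size of the ground set
  (\<open>sum_ordering_weight_le_1\<close>).

  For tightness, with prescribed sizes \<open>a 1, \<dots>, a d\<close> of sum \<open>N\<close>, take all tuples with these sizes that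
  partition \<open>{1..N}\<close>. They correspond to the words of length \<open>N\<close> containing each letter \<open>r\<close> exactly \<open>a r\<close>
  times, so their number is the multinomial coefficient and the sum is exactly \<open>1\<close>. Any two of them
  cross because two different rearrangements of the same letters order some pair of positions in
  opposite ways (\<open>ex_inversion_if_mset_eq\<close>).
\<close>

section \<open>Ordering weights and crossing tuples\<close>

text \<open>
  The probability that a random ordering lists \<open>P 1, \<dots>, P d\<close> block after block: of the orderings of
  the union, those obtained by ordering each block separately are the favourable ones.
\<close>

definition ordering_weight :: "nat \<Rightarrow> (nat \<Rightarrow> 'a set) \<Rightarrow> real" where
  "ordering_weight d P = (\<Prod>r = 1..d. fact (card (P r))) / fact (\<Sum>r = 1..d. card (P r))"

text \<open>
  An ordering starting with \<open>x\<close> can list \<open>P 1, \<dots>, P d\<close> block after block only under this condition.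
  It holds for every \<open>x\<close> outside all the blocks.
\<close>

definition can_come_first :: "nat \<Rightarrow> (nat \<Rightarrow> 'a set) \<Rightarrow> 'a \<Rightarrow> bool" where
  "can_come_first d P x \<longleftrightarrow> (\<forall>r\<in>{1..d}. x \<in> P r \<longrightarrow> (\<forall>q\<in>{1..<r}. P q = {}))"

definition crossing :: "nat \<Rightarrow> (nat \<Rightarrow> 'a set) \<Rightarrow> (nat \<Rightarrow> 'a set) \<Rightarrow> bool" where
  "crossing d P Q \<longleftrightarrow>
     (\<exists>u1 u2 v1 v2. 1 \<le> u1 \<and> u1 < u2 \<and> u2 \<le> d \<and> 1 \<le> v1 \<and> v1 < v2 \<and> v2 \<le> d \<and>
        P u1 \<inter> Q v2 \<noteq> {} \<and> P u2 \<inter> Q v1 \<noteq> {})"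

lemma crossing_sym: "crossing d P Q \<Longrightarrow> crossing d Q P"
  unfolding crossing_def by (metis inf_commute)

lemma strong_bollobas_system_iff:
  "strong_bollobas_system n d m A \<longleftrightarrow>
     (\<forall>i\<in>{1..m}. d_partition n d (A i)) \<and>
     (\<forall>i j. 1 \<le> i \<and> i < j \<and> j \<le> m \<longrightarrow> crossing d (A i) (A j))"
  unfolding strong_bollobas_system_def crossing_def by (rule refl)

lemma inverse_multinomial_eq_ordering_weight:
  "inverse (multinomial (\<Sum>r = 1..d. card (P r)) d (\<lambda>r. card (P r))) = ordering_weight d P"
  by (simp add: multinomial_def ordering_weight_def divide_inverse)

lemma ordering_weight_cong:
  "(\<And>r. r \<in> {1..d} \<Longrightarrow> P r = Q r) \<Longrightarrow> ordering_weight d P = ordering_weight d Q"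
  unfolding ordering_weight_def
  by (auto intro!: arg_cong2[where f = "(/)"] prod.cong arg_cong[where f = fact] sum.cong)

text \<open>
  Removing one of the \<open>k\<close> elements of a block divides the product of factorials by \<open>k\<close> and the
  factorial of the total size \<open>N\<close> by \<open>N\<close>.
\<close>

lemma ordering_weight_remove:
  assumes fin: "\<And>r. r \<in> {1..d} \<Longrightarrow> finite (P r)"
    and disj: "disjoint_family_on P {1..d}"
    and s: "s \<in> {1..d}" and x: "x \<in> P s"
  shows "card (P s) * ordering_weight d (\<lambda>r. P r - {x}) =
         (\<Sum>r = 1..d. card (P r)) * ordering_weight d P"
proof -
  have other: "P r - {x} = P r" if "r \<in> {1..d} - {s}" for r
    using disjoint_family_onD[OF disj, of r s] that s x by auto
  obtain k where k: "card (P s) = Suc k"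
    using fin[OF s] x by (metis card_gt_0_iff empty_iff gr0_conv_Suc)
  have k': "card (P s - {x}) = k"
    using fin[OF s] x k by simp
  define p :: real where "p = (\<Prod>r\<in>{1..d} - {s}. fact (card (P r)))"
  define N where "N = (\<Sum>r\<in>{1..d} - {s}. card (P r))"
  have rest: "(\<Prod>r\<in>{1..d} - {s}. fact (card (P r - {x}))) = p"
      "(\<Sum>r\<in>{1..d} - {s}. card (P r - {x})) = N"
    unfolding p_def N_def by (intro prod.cong sum.cong refl; simp only: other)+
  have prods: "(\<Prod>r = 1..d. fact (card (P r))) = fact (Suc k) * p"
      "(\<Prod>r = 1..d. fact (card (P r - {x}))) = fact k * p"
    unfolding prod.remove[OF finite_atLeastAtMost s] rest k k' by (simp_all only: p_def)
  have sums: "(\<Sum>r = 1..d. card (P r)) = Suc k + N" "(\<Sum>r = 1..d. card (P r - {x})) = k + N"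
    unfolding sum.remove[OF finite_atLeastAtMost s] rest k k' by (simp_all only: N_def)
  show ?thesis
    unfolding ordering_weight_def prods sums k by (simp add: field_simps del: of_nat_Suc)
qed

section \<open>The upper bound\<close>

text \<open>
  This is the law of total probability for the first element \<open>x\<close> of a random ordering of \<open>S\<close>, multiplied
  by \<open>card S\<close>. Let \<open>N\<close> be the total size of the blocks and \<open>w\<close> the weight. Each of the \<open>card S - N\<close>
  elements outside the blocks leaves the weight unchanged. Inside the blocks only the elements of the
  first nonempty block can come first; if there are \<open>k\<close> of them, each contributes \<open>N * w / k\<close>, so
  together they contribute \<open>N * w\<close>.
\<close>

lemma sum_ordering_weight_remove_first:
  assumes S: "finite S"
    and sub: "\<And>r. r \<in> {1..d} \<Longrightarrow> P r \<subseteq> S"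
    and disj: "disjoint_family_on P {1..d}"
  shows "(\<Sum>x | x \<in> S \<and> can_come_first d P x. ordering_weight d (\<lambda>r. P r - {x})) =
         card S * ordering_weight d P"
proof -
  define U where "U = (\<Union>r\<in>{1..d}. P r)"
  let ?N = "\<Sum>r = 1..d. card (P r)"
  have fin: "finite (P r)" if "r \<in> {1..d}" for r
    using sub[OF that] S finite_subset by blast
  have U: "U \<subseteq> S" "finite U"
    using sub fin unfolding U_def by blast+
  have card_U: "card U = ?N"
    unfolding U_def using fin disj by (intro card_UN_disjoint) (auto simp: disjoint_family_on_def)
  have outside: "(\<Sum>x\<in>S - U. ordering_weight d (\<lambda>r. P r - {x})) = (card S - ?N) * ordering_weight d P"
  proof -
    have "ordering_weight d (\<lambda>r. P r - {x}) = ordering_weight d P" if "x \<in> S - U" for x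
      using that by (intro ordering_weight_cong) (auto simp: U_def)
    then show ?thesis
      using U S by (simp add: card_Diff_subset card_U)
  qed
  have inside: "(\<Sum>x | x \<in> U \<and> can_come_first d P x. ordering_weight d (\<lambda>r. P r - {x})) =
      ?N * ordering_weight d P"
  proof (cases "U = {}")
    case True
    then show ?thesis using card_U by simp
  next
    case False
    define s where "s = (LEAST r. r \<in> {1..d} \<and> P r \<noteq> {})"
    have ex: "\<exists>r. r \<in> {1..d} \<and> P r \<noteq> {}"
      using False by (auto simp: U_def)
    have s: "s \<in> {1..d}" "P s \<noteq> {}"
      using LeastI_ex[OF ex] unfolding s_def by auto
    have before: "P q = {}" if "q \<in> {1..<s}" for q
      using not_less_Least[of q "\<lambda>r. r \<in> {1..d} \<and> P r \<noteq> {}"] that s(1) unfolding s_def by auto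
    have "{x. x \<in> U \<and> can_come_first d P x} = P s"
    proof (intro set_eqI iffI)
      fix x assume "x \<in> {x. x \<in> U \<and> can_come_first d P x}"
      then obtain r where r: "r \<in> {1..d}" "x \<in> P r" "\<forall>q\<in>{1..<r}. P q = {}"
        by (auto simp: U_def can_come_first_def)
      have "\<not> r < s" "\<not> s < r"
        using before[of r] r s by auto
      then show "x \<in> P s" using r(2) by simp
    next
      fix x assume x: "x \<in> P s"
      have "r = s" if "r \<in> {1..d}" "x \<in> P r" for r
        using disjoint_family_onD[OF disj, of r s] that s x by blast
      then show "x \<in> {x. x \<in> U \<and> can_come_first d P x}"
        unfolding U_def can_come_first_def using x s(1) before by blast
    qed
    moreover have "(\<Sum>x\<in>P s. ordering_weight d (\<lambda>r. P r - {x})) = ?N * ordering_weight d P"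
    proof -
      have pos: "real (card (P s)) > 0"
        using s fin by (simp add: card_gt_0_iff)
      have "ordering_weight d (\<lambda>r. P r - {x}) = ?N * ordering_weight d P / card (P s)"
        if "x \<in> P s" for x
        using ordering_weight_remove[OF fin disj s(1) that] pos
        by (metis less_irrefl nonzero_mult_div_cancel_left)
      then show ?thesis using pos by simp
    qed
    ultimately show ?thesis by simp
  qed
  have "{x. x \<in> S \<and> can_come_first d P x} = (S - U) \<union> {x. x \<in> U \<and> can_come_first d P x}"
    using U(1) by (auto simp: U_def can_come_first_def)
  then have "(\<Sum>x | x \<in> S \<and> can_come_first d P x. ordering_weight d (\<lambda>r. P r - {x})) =
      (card S - ?N) * ordering_weight d P + ?N * ordering_weight d P"
    using S U by (simp add: sum.union_disjoint[of "S - U"] outside inside disjoint_iff)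
  also have "\<dots> = card S * ordering_weight d P"
    using card_mono[OF S U(1)] card_U by (simp add: distrib_right[symmetric] del: of_nat_sum)
  finally show ?thesis .
qed

text \<open>
  The witnesses of the crossing differ from \<open>x\<close>: one of them lies in \<open>P u1\<close> and in \<open>Q v2\<close>, the other in
  \<open>P u2\<close> and in \<open>Q v1\<close>, so each lies in a block, of \<open>Q\<close> or of \<open>P\<close>, that has a nonempty block before it.
\<close>

lemma crossing_remove_first:
  assumes "crossing d P Q" "can_come_first d P x" "can_come_first d Q x"
  shows "crossing d (\<lambda>r. P r - {x}) (\<lambda>r. Q r - {x})"
proof -
  obtain u1 u2 v1 v2 y z where *: "1 \<le> u1" "u1 < u2" "u2 \<le> d" "1 \<le> v1" "v1 < v2" "v2 \<le> d"
      "y \<in> P u1" "y \<in> Q v2" "z \<in> P u2" "z \<in> Q v1"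
    using assms(1) unfolding crossing_def by blast
  have "y \<noteq> x"
    using assms(3) * unfolding can_come_first_def by fastforce
  moreover have "z \<noteq> x"
    using assms(2) * unfolding can_come_first_def by fastforce
  ultimately show ?thesis
    using * unfolding crossing_def by blast
qed

text \<open>
  By the averaging identity, \<open>card S\<close> times the sum is a sum over the possible first elements \<open>x\<close>. For
  each \<open>x\<close>, the tuples that still allow \<open>x\<close> to come first form, after the removal of \<open>x\<close>, a crossing
  family on \<open>S - {x}\<close>.
\<close>

theorem sum_ordering_weight_le_1:
  assumes "finite S" and "finite I"
    and "\<And>i r. i \<in> I \<Longrightarrow> r \<in> {1..d} \<Longrightarrow> P i r \<subseteq> S"
    and "\<And>i. i \<in> I \<Longrightarrow> disjoint_family_on (P i) {1..d}"
    and "\<And>i j. i \<in> I \<Longrightarrow> j \<in> I \<Longrightarrow> i \<noteq> j \<Longrightarrow> crossing d (P i) (P j)"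
  shows "(\<Sum>i\<in>I. ordering_weight d (P i)) \<le> 1"
  using assms
proof (induction "card S" arbitrary: S I P)
  case 0
  then have empty: "P i r = {}" if "i \<in> I" "r \<in> {1..d}" for i r
    using that by auto
  have "\<not> crossing d (P i) (P j)" if "i \<in> I" for i j
    using empty[OF that] unfolding crossing_def
    by (metis Int_empty_left atLeastAtMost_iff le_trans less_imp_le)
  then have "i = j" if "i \<in> I" "j \<in> I" for i j
    using "0.prems"(5) that by blast
  then have "card I \<le> 1"
    using \<open>finite I\<close> by (simp add: card_le_Suc0_iff_eq)
  moreover have "ordering_weight d (P i) = 1" if "i \<in> I" for i
    using empty[OF that] by (simp add: ordering_weight_def)
  ultimately show ?case by simp
next
  case (Suc k)
  let ?J = "\<lambda>x. {i \<in> I. can_come_first d (P i) x}"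
  have "card S * (\<Sum>i\<in>I. ordering_weight d (P i)) =
      (\<Sum>i\<in>I. \<Sum>x | x \<in> S \<and> can_come_first d (P i) x. ordering_weight d (\<lambda>r. P i r - {x}))"
    unfolding sum_distrib_left
    using Suc.prems by (intro sum.cong refl sum_ordering_weight_remove_first[symmetric]) auto
  also have "\<dots> = (\<Sum>x\<in>S. \<Sum>i\<in>?J x. ordering_weight d (\<lambda>r. P i r - {x}))"
    using Suc.prems by (intro sum.swap_restrict)
  also have "\<dots> \<le> (\<Sum>x\<in>S. 1)"
  proof (rule sum_mono)
    fix x assume x: "x \<in> S"
    show "(\<Sum>i\<in>?J x. ordering_weight d (\<lambda>r. P i r - {x})) \<le> 1"
    proof (rule Suc.hyps(1)[of "S - {x}"])
      show "k = card (S - {x})"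
        using Suc.hyps(2) x Suc.prems(1) by simp
    next
      fix i assume "i \<in> ?J x"
      then show "disjoint_family_on (\<lambda>r. P i r - {x}) {1..d}"
        using Suc.prems(4)[of i] unfolding disjoint_family_on_def by blast
    next
      fix i j assume "i \<in> ?J x" "j \<in> ?J x" "i \<noteq> j"
      then show "crossing d (\<lambda>r. P i r - {x}) (\<lambda>r. P j r - {x})"
        using Suc.prems(5) by (intro crossing_remove_first) auto
    qed (use Suc.prems(1-3) in \<open>simp_all, blast\<close>)
  qed
  finally have "card S * (\<Sum>i\<in>I. ordering_weight d (P i)) \<le> real (card S) * 1" by simp
  then show ?case
    by (rule mult_left_le_imp_le) (use Suc.hyps(2) in linarith)
qed

corollary bollobas_sum_le_1:
  assumes "strong_bollobas_system n d m A"
  shows "bollobas_sum d m A \<le> 1"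
proof -
  have part: "d_partition n d (A i)" if "i \<in> {1..m}" for i
    using assms that unfolding strong_bollobas_system_iff by blast
  have less: "crossing d (A i) (A j)" if "1 \<le> i" "i < j" "j \<le> m" for i j
    using assms that unfolding strong_bollobas_system_iff by blast
  have "crossing d (A i) (A j)" if "i \<in> {1..m}" "j \<in> {1..m}" "i \<noteq> j" for i j
    using that less[of i j] less[of j i] crossing_sym[of d "A j" "A i"] by (cases "i < j") auto
  then have "(\<Sum>i = 1..m. ordering_weight d (A i)) \<le> 1"
    using part by (intro sum_ordering_weight_le_1[of "{1..n}"]) (auto simp: d_partition_def)
  then show ?thesis
    by (simp only: bollobas_sum_def inverse_multinomial_eq_ordering_weight)
qed

section \<open>Tightness\<close>

text \<open>Positions are counted from \<open>1\<close>, so that those of a word of length \<open>N\<close> form \<open>{1..N}\<close>.\<close>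

definition positions :: "'a list \<Rightarrow> 'a \<Rightarrow> nat set" where
  "positions w r = {k \<in> {1..length w}. w ! (k - 1) = r}"

lemma card_positions: "card (positions w r) = count (mset w) r"
proof -
  have "k \<in> positions w r \<longleftrightarrow> k \<in> Suc ` {i. i < length w \<and> w ! i = r}" for k
    by (cases k) (auto simp: positions_def)
  then have "positions w r = Suc ` {i. i < length w \<and> w ! i = r}"
    by blast
  then have "card (positions w r) = card {i. i < length w \<and> w ! i = r}"
    by (simp add: card_image)
  also have "\<dots> = count (mset w) r"
    by (simp only: count_mset count_list_eq_length_filter length_filter_conv_card eq_commute[of r])
  finally show ?thesis .
qed

text \<open>
  Consider the set of positions carrying a letter at most \<open>t\<close>, once for \<open>v\<close> and once for \<open>w\<close>. Both sets
  have the same size. A position in the first set only and one in the second set only would form an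
  inversion; without inversions the two sets are therefore comparable, hence equal. If they are equal
  for every \<open>t\<close>, the words agree.
\<close>

lemma ex_inversion_if_mset_eq:
  fixes v w :: "'a :: linorder list"
  assumes eq: "mset v = mset w" and neq: "v \<noteq> w"
  shows "\<exists>i<length v. \<exists>j<length v. v ! i < v ! j \<and> w ! j < w ! i"
proof (rule ccontr)
  assume no: "\<not> ?thesis"
  have len: "length v = length w"
    using eq by (rule mset_eq_length)
  define L where "L u t = {i. i < length u \<and> u ! i \<le> t}" for u :: "'a list" and t
  have L_eq: "L v t = L w t" for t
  proof -
    have "card (L u t) = size (filter_mset (\<lambda>y. y \<le> t) (mset u))" for u
      by (simp add: L_def length_filter_conv_card flip: mset_filter)
    then have card: "card (L v t) = card (L w t)"
      by (simp add: eq)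
    have "L v t \<subseteq> L w t \<or> L w t \<subseteq> L v t"
    proof (rule ccontr)
      assume "\<not> ?thesis"
      then obtain i j where "i \<in> L v t" "i \<notin> L w t" "j \<in> L w t" "j \<notin> L v t"
        by blast
      then have "i < length v" "j < length v" "v ! i < v ! j" "w ! j < w ! i"
        using len by (auto simp: L_def)
      then show False using no by blast
    qed
    moreover have "finite (L u t)" for u
      by (simp add: L_def)
    ultimately show ?thesis
      using card card_subset_eq by metis
  qed
  have "v ! i = w ! i" if "i < length v" for i
  proof (rule antisym)
    show "v ! i \<le> w ! i" using L_eq[of "w ! i"] that len by (auto simp: L_def)
    show "w ! i \<le> v ! i" using L_eq[of "v ! i"] that len by (auto simp: L_def)
  qed
  then show False
    using neq len nth_equalityI by blast
qed

lemma crossing_positions: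
  assumes "mset v = mset w" and "v \<noteq> w" and "set v \<subseteq> {1..d}"
  shows "crossing d (positions v) (positions w)"
proof -
  obtain i j where ij: "i < length v" "j < length v" "v ! i < v ! j" "w ! j < w ! i"
    using ex_inversion_if_mset_eq[OF assms(1,2)] by blast
  have "length v = length w" "set w = set v"
    using assms(1) mset_eq_length mset_eq_setD by metis+
  then have "v ! i \<in> {1..d}" "v ! j \<in> {1..d}" "w ! i \<in> {1..d}" "w ! j \<in> {1..d}"
      "Suc i \<in> positions v (v ! i) \<inter> positions w (w ! i)"
      "Suc j \<in> positions v (v ! j) \<inter> positions w (w ! j)"
    using assms(3) ij nth_mem by (auto simp: positions_def subset_iff)
  then show ?thesis
    unfolding crossing_def using ij(3,4)
    by (intro exI[of _ "v ! i"] exI[of _ "v ! j"] exI[of _ "w ! j"] exI[of _ "w ! i"]) auto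
qed

text \<open>
  The index \<open>i\<close> runs through an enumeration of the words in which each letter \<open>r\<close> of \<open>{1..d}\<close> occurs
  \<open>a r\<close> times, and the blocks of the \<open>i\<close>-th tuple are the sets of positions of the letters.
\<close>

lemma ex_tight_system:
  assumes "(\<Sum>r = 1..d. a r) \<le> n"
  shows "\<exists>m A. strong_bollobas_system n d m A \<and>
           (\<forall>i\<in>{1..m}. \<forall>r\<in>{1..d}. card (A i r) = a r) \<and> bollobas_sum d m A = 1"
proof -
  define M where "M = (\<Sum>r = 1..d. replicate_mset (a r) r)"
  define W where "W = permutations_of_multiset M"
  define m where "m = card W"
  have count: "count M r = (if r \<in> {1..d} then a r else 0)" for r
    by (simp add: M_def count_sum)
  have size: "size M = (\<Sum>r = 1..d. a r)"
    by (simp add: M_def size_multiset_sum)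
  have set: "set_mset M \<subseteq> {1..d}"
    by (metis count count_eq_zero_iff subsetI)
  have "finite W"
    by (simp add: W_def)
  then obtain h where h: "bij_betw h {1..m} W"
    using ex_bij_betw_nat_finite_1 unfolding m_def by blast
  define A where "A i = positions (h i)" for i
  have word: "mset (h i) = M" if "i \<in> {1..m}" for i
    using bij_betwE[OF h] that by (auto simp: W_def permutations_of_multiset_def)
  have card: "card (A i r) = a r" if "i \<in> {1..m}" "r \<in> {1..d}" for i r
    using that by (simp add: A_def card_positions word count)
  have "strong_bollobas_system n d m A"
    unfolding strong_bollobas_system_iff
  proof (intro conjI allI impI ballI)
    fix i assume "i \<in> {1..m}"
    then have "length (h i) \<le> n"
      using assms word size by (metis size_mset)
    then show "d_partition n d (A i)"
      by (auto simp: d_partition_def A_def positions_def disjoint_family_on_def)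
  next
    fix i j assume "1 \<le> i \<and> i < j \<and> j \<le> m"
    then have ij: "i \<in> {1..m}" "j \<in> {1..m}" "i \<noteq> j" by auto
    have "h i \<noteq> h j"
      using ij inj_onD[OF bij_betw_imp_inj_on[OF h]] by blast
    moreover have "mset (h i) = mset (h j)"
      using word ij by simp
    moreover have "set (h i) \<subseteq> {1..d}"
      using set word[OF ij(1)] by (metis set_mset_mset)
    ultimately show "crossing d (A i) (A j)"
      unfolding A_def by (intro crossing_positions)
  qed
  moreover have "bollobas_sum d m A = 1"
  proof -
    have "(\<Prod>r\<in>set_mset M. fact (count M r)) = (\<Prod>r = 1..d. fact (a r) :: nat)"
      using set by (intro prod.mono_neutral_cong_left) (auto simp: count not_in_iff)
    then have "m * (\<Prod>r = 1..d. fact (a r)) = fact (\<Sum>r = 1..d. a r)"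
      using card_permutations_of_multiset_aux[of M] by (simp only: m_def W_def size)
    then have "real (m * (\<Prod>r = 1..d. fact (a r))) = real (fact (\<Sum>r = 1..d. a r))"
      by (rule arg_cong)
    then have number: "real m * (\<Prod>r = 1..d. fact (a r)) = fact (\<Sum>r = 1..d. a r)"
      by (simp only: of_nat_mult of_nat_prod of_nat_fact)
    have "ordering_weight d (A i) = (\<Prod>r = 1..d. fact (a r)) / fact (\<Sum>r = 1..d. a r)"
      if "i \<in> {1..m}" for i
      unfolding ordering_weight_def using card[OF that] by simp
    then have "bollobas_sum d m A =
        (\<Sum>i = 1..m. (\<Prod>r = 1..d. fact (a r)) / fact (\<Sum>r = 1..d. a r))"
      unfolding bollobas_sum_def inverse_multinomial_eq_ordering_weight by (intro sum.cong refl)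
    also have "\<dots> = real m * (\<Prod>r = 1..d. fact (a r)) / fact (\<Sum>r = 1..d. a r)"
      by simp
    also have "\<dots> = 1"
      unfolding number by simp
    finally show ?thesis .
  qed
  ultimately show ?thesis
    using card by blast
qed

theorem theorem1p10:
  fixes n d :: nat
  assumes "n \<ge> 1" and "d \<ge> 2"
  shows "(\<forall>m A. strong_bollobas_system n d m A \<longrightarrow> bollobas_sum d m A \<le> 1) \<and>
         (\<forall>a :: nat \<Rightarrow> nat. (\<Sum>r = 1..d. a r) \<le> n \<longrightarrow>
            (\<exists>m A. strong_bollobas_system n d m A \<and>
                   (\<forall>i\<in>{1..m}. \<forall>r\<in>{1..d}. card (A i r) = a r) \<and>
                   bollobas_sum d m A = 1))"
  using bollobas_sum_le_1 ex_tight_system by blast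

end
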